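(* There exists $\epsilon_0>0$ such that for all $\epsilon \in(0,\epsilon_0]$ and every positive integer $K$: if $H$ is a mapping from unlabeled trees to sets of $K$ of their vertices with $$\liminf_{n\to+\infty}\ \mathbb{P}\left(1\in H(\mathrm{UA}(n)^\circ)\right)\ge 1-\epsilon,$$ then $$K \geq \exp\left( \sqrt{\frac{1}{30} \log \frac{1}{2\epsilon}}\right).$$
   Context: Write $[n]=\{1,\dots,n\}$. The uniform attachment tree $\mathrm{UA}(n)$, $n\ge 2$, is the random labeled tree on vertex set $[n]$ defined inductively: $\mathrm{UA}(2)$ is the unique tree on two vertices, and $\mathrm{UA}(n+1)$ is obtained from $\mathrm{UA}(n)$ by adding the vertex $n+1$ and an edge $\{i,n+1\}$ with $i\in[n]$ chosen uniformly at random. For a labeled tree $T$, $T^\circ$ denotes its isomorphism class, i.e. the unlabeled copy of $T$. $H$ needs to be defined only on trees with at least $K$ vertices. The vertices of the unlabeled tree are identified with those of the labeled tree through an isomorphism that carries no information on the original labels. Concretely: $H$ may be viewed as a function from labeled trees on $[n]$ to $K$-subsets of $[n]$, and the event $1\in H(\mathrm{UA}(n)^\circ)$ means $\sigma(1)\in H(\sigma(\mathrm{UA}(n)))$, where $\sigma$ is a uniformly random permutation of $[n]$ independent of the tree and $\sigma(T)$ is $T$ with its vertices relabeled by $\sigma$. *)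

theory Defs
  imports "HOL-Probability.Probability" "HOL-Combinatorics.Permutations"
begin

type_synonym lgraph = "nat set \<times> nat set set"

definition is_tree :: "lgraph \<Rightarrow> bool" where
  "is_tree T \<longleftrightarrow> (case T of (V, E) \<Rightarrow>
     finite V \<and> V \<noteq> {} \<and> (\<forall>e\<in>E. e \<subseteq> V \<and> card e = 2) \<and>
     (\<forall>u\<in>V. \<forall>v\<in>V. (u, v) \<in> {(a, b). {a, b} \<in> E}\<^sup>*) \<and>
     \<not> (\<exists>xs. length xs \<ge> 3 \<and> distinct xs \<and>
           successively (\<lambda>a b. {a, b} \<in> E) xs \<and> {last xs, hd xs} \<in> E))"

(* Only n \<ge> 2 is meaningful; UA 0 and UA 1 are dummy values. *)
fun UA :: "nat \<Rightarrow> lgraph pmf" where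
  "UA n =
    (if n \<le> 2 then return_pmf ({1, 2}, {{1, 2}})
     else do {
       (V, E) \<leftarrow> UA (n - 1);
       i \<leftarrow> pmf_of_set {1..n - 1};
       return_pmf (insert n V, insert {i, n} E)
     })"

declare UA.simps [simp del]

definition relabel :: "(nat \<Rightarrow> nat) \<Rightarrow> lgraph \<Rightarrow> lgraph" where
  "relabel \<sigma> T = (case T of (V, E) \<Rightarrow> (\<sigma> ` V, (\<lambda>e. \<sigma> ` e) ` E))"

(* H is given on labeled trees and need not commute with relabeling: the labels are made
   uninformative by the uniform relabeling in prob_root_in. Its values on anything
   other than a tree on {1..n} with n \<ge> K are unconstrained. *)
definition selects_vertices :: "nat \<Rightarrow> (lgraph \<Rightarrow> nat set) \<Rightarrow> bool" where
  "selects_vertices K H \<longleftrightarrow>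
     (\<forall>n\<ge>K. \<forall>E. is_tree ({1..n}, E) \<longrightarrow>
        H ({1..n}, E) \<subseteq> {1..n} \<and> card (H ({1..n}, E)) = K)"

(* The probability that the root 1 lies in H applied to the unlabeled copy of UA n. *)
definition prob_root_in :: "(lgraph \<Rightarrow> nat set) \<Rightarrow> nat \<Rightarrow> real" where
  "prob_root_in H n =
     measure_pmf.prob (pair_pmf (UA n) (pmf_of_set {\<sigma>. \<sigma> permutes {1..n}}))
       {(T, \<sigma>). \<sigma> 1 \<in> H (relabel \<sigma> T)}"

end

theory Submission imports Defs begin

text \<open>
  A selection of \<open>K\<close> vertices cannot contain all of the first \<open>2 K\<close> vertices, so some vertex
  \<open>v \<le> 2 K\<close> is missed with probability at least \<open>1/2\<close>. The point is that missing \<open>v\<close> and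
  missing the root are comparable: if \<open>v\<close> has depth at most \<open>D\<close>, then the tree rerooted at
  \<open>v\<close>, with its vertices renumbered suitably, is again a possible outcome of the attachment
  process, with the same probability as the original one, and the selection sees the same
  unlabeled tree in both cases. The only loss is the number of original trees that lead to the
  same rerooted tree, which is at most \<open>v ^ D\<close>
  (\<open>sum_misses_shallow_le\<close>).

  Rerooting is done one edge at a time. If \<open>c\<close> is a child of the root \<open>1\<close>, then giving \<open>c\<close> the
  label \<open>1\<close> and shifting the labels below \<open>c\<close> up by one yields an increasing tree again. For a
  known \<open>c\<close> this step can be undone, and it brings each vertex of the branch of \<open>c\<close> closer to
  the root by one while the labels above \<open>c\<close> do not change. So one step costs a factor of at
  most \<open>v\<close>, for the unknown \<open>c\<close>.

  Depths are controlled by the identity that \<open>2 ^ depth v\<close> has expectation exactly \<open>v\<close>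
  (\<open>sum_power2_depth\<close>). With \<open>4 K \<le> 2 ^ D\<close> Markov's inequality gives depth greater than
  \<open>D\<close> with probability at most \<open>1/4\<close>, so \<open>v\<close> is missed and shallow with probability at least
  \<open>1/4\<close>, and the root is missed with probability at least \<open>1 / (4 (2 K) ^ D)\<close>, for every
  \<open>n \<ge> 2 K\<close> (\<open>prob_root_in_le\<close>). As \<open>D\<close> is of order \<open>log K\<close>, this is
  \<open>exp (- O (log\<^sup>2 K))\<close>, and the constant 30 leaves room to spare.
\<close>

section \<open>Recursive trees and their parent functions\<close>

text \<open>
  Sampling functions instead of trees turns the attachment process into a uniform choice from a
  product of intervals, so that probabilities become cardinalities.
\<close>

definition parents :: "nat \<Rightarrow> (nat \<Rightarrow> nat) set" where
  "parents n = (\<Pi>\<^sub>E i\<in>{2..n}. {1..<i})"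

definition tree :: "nat \<Rightarrow> (nat \<Rightarrow> nat) \<Rightarrow> lgraph" where
  "tree n p = ({1..n}, (\<lambda>i. {p i, i}) ` {2..n})"

lemma finite_parents [simp]: "finite (parents n)"
  by (auto simp: parents_def intro: finite_PiE)

lemma parents_nonempty [simp]: "parents n \<noteq> {}"
  by (auto simp: parents_def PiE_eq_empty_iff)

lemma parent_less: "p \<in> parents n \<Longrightarrow> 2 \<le> v \<Longrightarrow> v \<le> n \<Longrightarrow> 1 \<le> p v \<and> p v < v"
  by (force simp: parents_def PiE_iff)

lemma parents_Suc:
  assumes "1 \<le> n"
  shows "parents (Suc n) = (\<lambda>(u, p). p(Suc n := u)) ` ({1..n} \<times> parents n)"
proof -
  have "{2..Suc n} = insert (Suc n) {2..n}" using assms by auto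
  then show ?thesis
    by (simp add: parents_def PiE_insert_eq atLeastLessThanSuc_atLeastAtMost)
qed

lemma inj_on_extend: "inj_on (\<lambda>(u, p). p(Suc n := u)) ({1..n} \<times> parents n)"
  using inj_combinator[of "Suc n" "{2..n}" "\<lambda>i. {1..<i}"]
  by (simp add: parents_def atLeastLessThanSuc_atLeastAtMost)

lemma sum_parents_Suc:
  assumes "1 \<le> n"
  shows "(\<Sum>p\<in>parents (Suc n). F p) = (\<Sum>u\<in>{1..n}. \<Sum>p\<in>parents n. F (p(Suc n := u)))"
  unfolding parents_Suc[OF assms] sum.reindex[OF inj_on_extend]
  by (simp add: sum.cartesian_product case_prod_unfold)

lemma pair_pmf_of_set:
  assumes "finite A" "A \<noteq> {}" "finite B" "B \<noteq> {}"
  shows "pair_pmf (pmf_of_set A) (pmf_of_set B) = pmf_of_set (A \<times> B)"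
proof (rule pmf_eqI)
  fix x :: "'a \<times> 'b"
  show "pmf (pair_pmf (pmf_of_set A) (pmf_of_set B)) x = pmf (pmf_of_set (A \<times> B)) x"
    using assms
    by (cases x) (simp add: pmf_pair pmf_of_set card_cartesian_product indicator_def)
qed

lemma UA_uniform:
  assumes "2 \<le> n"
  shows "UA n = map_pmf (tree n) (pmf_of_set (parents n))"
  using assms
proof (induction n rule: dec_induct)
  case base
  have "parents 2 = {(\<lambda>i. undefined)(2 := 1)}"
    by (auto simp: parents_def PiE_iff extensional_def fun_eq_iff split: if_splits)
  moreover have "{Suc 0..2} = {1, 2}" by auto
  ultimately show ?case by (simp add: UA.simps[of 2] tree_def pmf_of_set_singleton)
next
  case (step n)
  have n: "1 \<le> n" using step by simp
  have ext: "(case tree n p of (V, E) \<Rightarrow> (insert (Suc n) V, insert {u, Suc n} E))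
      = tree (Suc n) (p(Suc n := u))" for p u
  proof -
    have "{2..Suc n} = insert (Suc n) {2..n}" "{1..Suc n} = insert (Suc n) {1..n}"
      using n by auto
    then show ?thesis by (auto simp: tree_def)
  qed
  have "pmf_of_set (parents (Suc n)) =
      map_pmf (\<lambda>(u, p). p(Suc n := u)) (pmf_of_set ({1..n} \<times> parents n))"
    unfolding parents_Suc[OF n] using n
    by (subst map_pmf_of_set_inj[OF inj_on_extend]) auto
  also have "\<dots> = pmf_of_set {1..n} \<bind> (\<lambda>u. pmf_of_set (parents n) \<bind>
      (\<lambda>p. return_pmf (p(Suc n := u))))"
    using n by (simp add: pair_pmf_of_set[symmetric] pair_pmf_def map_bind_pmf)
  also have "\<dots> = pmf_of_set (parents n) \<bind> (\<lambda>p. pmf_of_set {1..n} \<bind>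
      (\<lambda>u. return_pmf (p(Suc n := u))))"
    by (rule bind_commute_pmf)
  finally have P: "pmf_of_set (parents (Suc n)) = \<dots>" .
  have "UA (Suc n) = UA n \<bind> (\<lambda>T. pmf_of_set {1..n} \<bind>
      (\<lambda>u. return_pmf (case T of (V, E) \<Rightarrow> (insert (Suc n) V, insert {u, Suc n} E))))"
    using step by (subst UA.simps) (simp add: case_prod_unfold)
  also have "\<dots> = pmf_of_set (parents n) \<bind> (\<lambda>p. pmf_of_set {1..n} \<bind>
      (\<lambda>u. return_pmf (tree (Suc n) (p(Suc n := u)))))"
    by (simp add: step.IH bind_map_pmf ext)
  also have "\<dots> = map_pmf (tree (Suc n)) (pmf_of_set (parents (Suc n)))"
    by (simp add: P map_bind_pmf)
  finally show ?case .
qed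

text \<open>
  Following \<open>q\<close> decreases \<open>h\<close> until the root is reached, which connects everything. On a cycle,
  a vertex with maximal \<open>h\<close> would have two distinct neighbours that are both its \<open>q\<close>-image.
  The height \<open>h\<close> is arbitrary because the labels of a randomly relabeled tree no longer increase
  away from the root.
\<close>

lemma is_tree_if_parents_descend:
  fixes h :: "nat \<Rightarrow> nat"
  assumes fin: "finite V" and r: "r \<in> V"
    and q: "\<And>x. x \<in> V \<Longrightarrow> x \<noteq> r \<Longrightarrow> q x \<in> V \<and> h (q x) < h x"
  shows "is_tree (V, (\<lambda>x. {q x, x}) ` (V - {r}))"
proof -
  define E where "E = (\<lambda>x. {q x, x}) ` (V - {r})"
  define R where "R = {(a, b). {a, b} \<in> E}"
  have edge: "y = q x" if "{x, y} \<in> E" "h y \<le> h x" for x y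
    using that q by (fastforce simp: E_def doubleton_eq_iff)
  have to_root: "(x, r) \<in> R\<^sup>*" if "x \<in> V" for x
    using that
  proof (induction "h x" arbitrary: x rule: less_induct)
    case less
    show ?case
    proof (cases "x = r")
      case False
      then have "(x, q x) \<in> R" using less.prems
        by (auto simp: R_def E_def insert_commute)
      moreover have "(q x, r) \<in> R\<^sup>*" using less q False by blast
      ultimately show ?thesis by (rule converse_rtrancl_into_rtrancl)
    qed simp
  qed
  have "sym R" by (auto simp: R_def sym_def insert_commute)
  then have from_root: "(r, x) \<in> R\<^sup>*" if "x \<in> V" for x
    using to_root[OF that] by (meson sym_rtrancl symD)
  have no_cycle: False
    if xs: "length xs \<ge> 3" "distinct xs" "successively (\<lambda>a b. {a, b} \<in> E) xs"
      "{last xs, hd xs} \<in> E" for xs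
  proof -
    let ?l = "length xs"
    have nxt: "{xs ! i, xs ! (Suc i mod ?l)} \<in> E" if "i < ?l" for i
    proof (cases "Suc i < ?l")
      case True
      then show ?thesis using xs(3) by (simp add: successively_conv_nth)
    next
      case False
      then have "i = ?l - 1" "Suc i = ?l" "xs \<noteq> []" using that by auto
      then show ?thesis using xs(4) by (simp add: last_conv_nth hd_conv_nth)
    qed
    have "finite (h ` set xs)" "h ` set xs \<noteq> {}" using xs(1) by auto
    then obtain m where m: "m \<in> set xs" "h m = Max (h ` set xs)"
      using Max_in by (metis imageE)
    have mx: "h y \<le> h m" if "y \<in> set xs" for y
      using that by (simp add: m(2))
    obtain i where i: "i < ?l" "xs ! i = m" using m(1) by (auto simp: in_set_conv_nth)
    \<comment> \<open>the positions just before and just after \<open>m\<close> on the cycle; they differ as there are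
      at least three\<close>
    define j where "j = (if i = 0 then ?l - 1 else i - 1)"
    have j: "j < ?l" "Suc j mod ?l = i" using i xs(1) by (auto simp: j_def)
    have k: "Suc i mod ?l < ?l" using xs(1) by (intro mod_less_divisor) auto
    have "xs ! (Suc i mod ?l) = q m"
      using nxt[OF i(1)] edge mx[OF nth_mem[OF k]] i(2) by simp
    moreover have "xs ! j = q m"
      using nxt[OF j(1)] edge mx[OF nth_mem[OF j(1)]] i(2) j(2) by (simp add: insert_commute)
    ultimately have "Suc i mod ?l = j"
      using xs(2) k j(1) by (metis nth_eq_iff_index_eq)
    then show False using xs(1) i(1) by (cases "Suc i = ?l") (auto simp: j_def split: if_splits)
  qed
  have "\<forall>e\<in>E. e \<subseteq> V \<and> card e = 2"
    using q by (fastforce simp: E_def card_2_iff)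
  moreover have "\<forall>u\<in>V. \<forall>v\<in>V. (u, v) \<in> R\<^sup>*"
    using to_root from_root by (meson rtrancl_trans)
  ultimately show ?thesis
    using fin r no_cycle unfolding is_tree_def E_def[symmetric] R_def by auto
qed

section \<open>Missing a vertex under a random relabeling\<close>

lemma relabel_relabel: "relabel \<sigma> (relabel \<rho> T) = relabel (\<sigma> \<circ> \<rho>) T"
  by (auto simp: relabel_def image_comp case_prod_unfold)

text \<open>This makes the cardinality of the selection available for every sampled tree.\<close>

lemma relabel_tree_is_tree:
  assumes p: "p \<in> parents n" and \<sigma>: "\<sigma> permutes {1..n}" and n: "1 \<le> n"
  shows "\<exists>E. relabel \<sigma> (tree n p) = ({1..n}, E) \<and> is_tree ({1..n}, E)"
proof -
  let ?q = "\<lambda>x. \<sigma> (p (inv \<sigma> x))"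
  have "is_tree ({1..n}, (\<lambda>x. {?q x, x}) ` ({1..n} - {\<sigma> 1}))"
  proof (rule is_tree_if_parents_descend[where h = "inv \<sigma>"])
    show "\<sigma> 1 \<in> {1..n}" using permutes_in_image[OF \<sigma>] n by auto
    fix x assume x: "x \<in> {1..n}" "x \<noteq> \<sigma> 1"
    then have "inv \<sigma> x \<in> {1..n}"
      using permutes_in_image[OF permutes_inv[OF \<sigma>]] by blast
    moreover have "inv \<sigma> x \<noteq> 1" using x permutes_inverses[OF \<sigma>] by metis
    ultimately have "1 \<le> p (inv \<sigma> x) \<and> p (inv \<sigma> x) < inv \<sigma> x" "inv \<sigma> x \<le> n"
      using parent_less[OF p, of "inv \<sigma> x"] by auto
    then show "?q x \<in> {1..n} \<and> inv \<sigma> (?q x) < inv \<sigma> x"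
      using permutes_in_image[OF \<sigma>] permutes_inverses[OF \<sigma>] by auto
  qed simp
  moreover have "relabel \<sigma> (tree n p) = ({1..n}, (\<lambda>x. {?q x, x}) ` ({1..n} - {\<sigma> 1}))"
  proof -
    have "{1..n} - {\<sigma> 1} = \<sigma> ` ({1..n} - {1})"
      using permutes_image[OF \<sigma>] permutes_inj[OF \<sigma>] by (simp add: image_set_diff)
    also have "{1..n} - {1} = {2..n}" by auto
    finally show ?thesis
      using permutes_image[OF \<sigma>] permutes_inverses[OF \<sigma>]
      by (simp add: relabel_def tree_def image_image)
  qed
  ultimately show ?thesis by blast
qed

text \<open>Up to the factor \<open>fact n\<close>, the probability that \<open>v\<close> is not selected, given the tree.\<close>

definition misses :: "(lgraph \<Rightarrow> nat set) \<Rightarrow> nat \<Rightarrow> (nat \<Rightarrow> nat) \<Rightarrow> nat \<Rightarrow> nat" where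
  "misses H n p v = card {\<sigma>. \<sigma> permutes {1..n} \<and> \<sigma> v \<notin> H (relabel \<sigma> (tree n p))}"

lemma finite_permutes [simp]: "finite {\<sigma>. \<sigma> permutes {a..b::nat}}"
  by (rule finite_permutations) simp

lemma misses_le: "misses H n p v \<le> fact n"
proof -
  have "misses H n p v \<le> card {\<sigma>. \<sigma> permutes {1..n}}"
    unfolding misses_def by (rule card_mono) auto
  then show ?thesis by (simp add: card_permutations[of _ n])
qed

lemma prob_root_in_eq_misses:
  assumes "2 \<le> n"
  shows "prob_root_in H n =
    1 - (\<Sum>p\<in>parents n. real (misses H n p 1)) / (card (parents n) * fact n)"
proof -
  let ?S = "{\<sigma>. \<sigma> permutes {1..n}}"
  let ?A = "{(p, \<sigma>). \<sigma> 1 \<in> H (relabel \<sigma> (tree n p))}"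
  let ?M = "pmf_of_set (parents n \<times> ?S)"
  have ne: "?S \<noteq> {}" using permutes_id by blast
  have "prob_root_in H n = measure_pmf.prob ?M ?A"
    using ne by (simp add: prob_root_in_def UA_uniform[OF assms] pair_map_pmf1
        pair_pmf_of_set measure_map_pmf vimage_def case_prod_unfold)
  also have "\<dots> = 1 - measure_pmf.prob ?M (- ?A)"
    using measure_pmf.prob_compl[of "- ?A" ?M] by (simp add: Compl_eq_Diff_UNIV[symmetric])
  also have "measure_pmf.prob ?M (- ?A) = card ((parents n \<times> ?S) \<inter> - ?A) / card (parents n \<times> ?S)"
    using ne by (intro measure_pmf_of_set) auto
  also have "(parents n \<times> ?S) \<inter> - ?A =
      (SIGMA p:parents n. {\<sigma>. \<sigma> permutes {1..n} \<and> \<sigma> 1 \<notin> H (relabel \<sigma> (tree n p))})"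
    by auto
  also have "card \<dots> = (\<Sum>p\<in>parents n. misses H n p 1)"
    unfolding misses_def by (rule card_SigmaI) auto
  finally show ?thesis by (simp add: card_cartesian_product card_permutations[of _ n])
qed

text \<open>
  Each single relabeling already loses at least \<open>card A - K\<close> vertices of \<open>A\<close>, because it maps
  them to distinct labels and only \<open>K\<close> labels are selected; the claim is the sum of this over all
  relabelings.
\<close>

lemma sum_misses_ge:
  assumes H: "selects_vertices K H" and p: "p \<in> parents n"
    and n: "1 \<le> n" "K \<le> n" and A: "A \<subseteq> {1..n}"
  shows "(card A - K) * fact n \<le> (\<Sum>v\<in>A. misses H n p v)"
proof -
  let ?S = "{\<sigma>. \<sigma> permutes {1..n}}"
  have fA: "finite A" using A finite_subset by blast
  have each: "card A - K \<le> card {v \<in> A. \<sigma> v \<notin> H (relabel \<sigma> (tree n p))}"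
    if \<sigma>: "\<sigma> permutes {1..n}" for \<sigma>
  proof -
    let ?B = "H (relabel \<sigma> (tree n p))"
    obtain E where "relabel \<sigma> (tree n p) = ({1..n}, E)" "is_tree ({1..n}, E)"
      using relabel_tree_is_tree[OF p \<sigma> n(1)] by blast
    then have B: "card ?B = K" "finite ?B"
      using H n finite_subset[of "H ({1..n}, E)" "{1..n}"] unfolding selects_vertices_def by auto
    have "card {v \<in> A. \<sigma> v \<in> ?B} = card (\<sigma> ` {v \<in> A. \<sigma> v \<in> ?B})"
      using permutes_inj[OF \<sigma>] by (simp add: card_image inj_on_subset)
    also have "\<dots> \<le> K" using B by (metis (no_types, lifting) card_mono image_subsetI mem_Collect_eq)
    finally have "card {v \<in> A. \<sigma> v \<in> ?B} \<le> K" .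
    moreover have "{v \<in> A. \<sigma> v \<notin> ?B} = A - {v \<in> A. \<sigma> v \<in> ?B}" by auto
    ultimately show ?thesis using fA by (simp add: card_Diff_subset)
  qed
  have "(\<Sum>v\<in>A. misses H n p v) =
      (\<Sum>v\<in>A. \<Sum>\<sigma>\<in>?S. if \<sigma> v \<notin> H (relabel \<sigma> (tree n p)) then 1 else 0)"
    unfolding misses_def by (simp add: sum.inter_filter[symmetric])
  also have "\<dots> = (\<Sum>\<sigma>\<in>?S. \<Sum>v\<in>A. if \<sigma> v \<notin> H (relabel \<sigma> (tree n p)) then 1 else 0)"
    by (rule sum.swap)
  also have "\<dots> = (\<Sum>\<sigma>\<in>?S. card {v \<in> A. \<sigma> v \<notin> H (relabel \<sigma> (tree n p))})"
    using fA by (simp add: sum.inter_filter[symmetric])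
  also have "\<dots> \<ge> (\<Sum>\<sigma>\<in>?S. card A - K)"
    using each by (intro sum_mono) auto
  finally show ?thesis by (simp add: card_permutations[of _ n] mult.commute)
qed

section \<open>Depth\<close>

text \<open>
  The test \<open>p v < v\<close> holds for all non-root vertices of a recursive tree; it makes the recursion
  terminate for arbitrary \<open>p\<close>.
\<close>

fun depth :: "(nat \<Rightarrow> nat) \<Rightarrow> nat \<Rightarrow> nat" where
  "depth p v = (if 1 < v \<and> p v < v then Suc (depth p (p v)) else 0)"

declare depth.simps [simp del]

lemma depth_cong: "(\<And>i. i \<le> v \<Longrightarrow> p i = p' i) \<Longrightarrow> depth p v = depth p' v"
proof (induction v rule: less_induct)
  case (less v)
  have "depth p (p v) = depth p' (p v)" if "p v < v"
    using less.IH[OF that] less.prems that by simp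
  then show ?case using less.prems[of v] by (simp add: depth.simps[of _ v])
qed

text \<open>
  The parent of \<open>n + 1\<close> is uniform on \<open>{1..n}\<close>, so if \<open>2 ^ depth u\<close> has mean \<open>u\<close> for all
  \<open>u \<le> n\<close>, then \<open>2 ^ depth (n + 1)\<close> has mean \<open>2 (1 + ... + n) / n = n + 1\<close>. The base 2 is
  what makes the mean reproduce itself.
\<close>

lemma sum_power2_depth:
  assumes "1 \<le> v" "v \<le> n"
  shows "(\<Sum>p\<in>parents n. 2 ^ depth p v) = v * card (parents n)"
  using assms
proof (induction n arbitrary: v)
  case (Suc n)
  show ?case
  proof (cases "n = 0")
    case True
    then have "v = 1" using Suc.prems by simp
    then show ?thesis by (simp add: depth.simps)
  next
    case False
    then have n: "1 \<le> n" by simp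
    have card: "card (parents (Suc n)) = n * card (parents n)"
      using sum_parents_Suc[OF n, of "\<lambda>_. 1::nat"] by simp
    show ?thesis
    proof (cases "v = Suc n")
      case True
      have "depth (p(Suc n := u)) v = Suc (depth p u)" if "u \<in> {1..n}" for p u
        using that True depth_cong[of u "p(Suc n := u)" p] by (simp add: depth.simps[of _ "Suc n"])
      then have "(\<Sum>p\<in>parents (Suc n). 2 ^ depth p v) =
          (2::nat) * (\<Sum>u\<in>{1..n}. \<Sum>p\<in>parents n. 2 ^ depth p u)"
        by (simp add: sum_parents_Suc[OF n] sum_distrib_left)
      also have "\<dots> = 2 * (\<Sum>u\<in>{1..n}. u) * card (parents n)"
        using Suc.IH by (simp add: sum_distrib_right)
      also have "2 * (\<Sum>u\<in>{1..n}. u) = n * Suc n"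
        using double_gauss_sum_from_Suc_0[of n, where 'a = nat] by simp
      finally show ?thesis using card True by (simp add: algebra_simps)
    next
      case False
      then have v: "1 \<le> v" "v \<le> n" using Suc.prems by auto
      then have "depth (p(Suc n := u)) v = depth p v" for p u
        by (intro depth_cong) auto
      then show ?thesis
        using Suc.IH[OF v] by (simp add: sum_parents_Suc[OF n] card)
    qed
  qed
qed simp

text \<open>Markov's inequality for \<open>2 ^ depth\<close>.\<close>

lemma card_deep_le:
  assumes "1 \<le> v" "v \<le> n"
  shows "card {p \<in> parents n. D < depth p v} * 2 ^ Suc D \<le> v * card (parents n)"
proof -
  have "card {p \<in> parents n. D < depth p v} * 2 ^ Suc D
      = (\<Sum>p\<in>{p \<in> parents n. D < depth p v}. 2 ^ Suc D)" by simp
  also have "\<dots> \<le> (\<Sum>p\<in>{p \<in> parents n. D < depth p v}. 2 ^ depth p v)"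
    by (intro sum_mono power_increasing) auto
  also have "\<dots> \<le> (\<Sum>p\<in>parents n. 2 ^ depth p v)"
    by (intro sum_mono2) auto
  finally show ?thesis using sum_power2_depth[OF assms] by simp
qed

section \<open>Moving the root to a neighbour\<close>

text \<open>The child of the root that is an ancestor of \<open>v\<close>, or \<open>v\<close> itself.\<close>

fun branch :: "(nat \<Rightarrow> nat) \<Rightarrow> nat \<Rightarrow> nat" where
  "branch p v = (if 1 < p v \<and> p v < v then branch p (p v) else v)"

declare branch.simps [simp del]

lemma branch_child_of_root:
  assumes "p \<in> parents n" "2 \<le> v" "v \<le> n"
  shows "2 \<le> branch p v \<and> branch p v \<le> v \<and> p (branch p v) = 1"
  using assms(2,3)
proof (induction v rule: less_induct)
  case (less v)
  have "1 \<le> p v" "p v < v" using parent_less[OF assms(1)] less.prems by auto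
  then show ?case using less.IH[of "p v"] less.prems
    by (cases "p v = 1") (auto simp: branch.simps[of p v])
qed

definition rot :: "nat \<Rightarrow> nat \<Rightarrow> nat" where
  "rot c x = (if x = c then 1 else if 1 \<le> x \<and> x < c then Suc x else x)"

text \<open>An explicit inverse of \<open>rot c\<close>.\<close>

definition unrot :: "nat \<Rightarrow> nat \<Rightarrow> nat" where
  "unrot c y = (if y = 1 then c else if 2 \<le> y \<and> y \<le> c then y - 1 else y)"

lemma unrot_rot: "1 \<le> c \<Longrightarrow> unrot c (rot c x) = x"
  by (auto simp: rot_def unrot_def)

lemma rot_permutes: "1 \<le> c \<Longrightarrow> c \<le> n \<Longrightarrow> rot c permutes {1..n}"
  by (rule bij_imp_permutes, rule bij_betwI[where g = "unrot c"])
    (auto simp: rot_def unrot_def)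

text \<open>
  The parent function after \<open>c\<close> has become the root. All edges keep their direction except the
  one between \<open>c\<close> and the old root: the latter now has label 2 and parent 1, which is \<open>c\<close>.
\<close>

definition reroot :: "nat \<Rightarrow> nat \<Rightarrow> (nat \<Rightarrow> nat) \<Rightarrow> nat \<Rightarrow> nat" where
  "reroot n c p = (\<lambda>y\<in>{2..n}. if y = 2 then 1 else rot c (p (unrot c y)))"

text \<open>
  The rotation preserves the order of all labels but \<open>c\<close>, and \<open>c\<close> moves below all others. So an
  edge can only violate the increasing order if it leads from \<open>c\<close> to its parent, and that is the
  edge which is reversed.
\<close>

lemma reroot_parents:
  assumes p: "p \<in> parents n" and c: "2 \<le> c" "c \<le> n"
  shows "reroot n c p \<in> parents n"
proof -
  have "1 \<le> rot c (p (unrot c y)) \<and> rot c (p (unrot c y)) < y" if "2 < y" "y \<le> n" for y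
  proof -
    have x: "2 \<le> unrot c y" "unrot c y \<le> n" using that c by (auto simp: unrot_def)
    show ?thesis using parent_less[OF p x] that c by (auto simp: unrot_def rot_def)
  qed
  then show ?thesis by (auto simp: parents_def reroot_def)
qed

lemma reroot_rot:
  assumes "2 \<le> c" "2 \<le> x" "x \<le> n" "c \<le> n" "x \<noteq> c"
  shows "reroot n c p (rot c x) = rot c (p x)"
proof -
  have "rot c x \<in> {2..n}" "rot c x \<noteq> 2" using assms by (auto simp: rot_def)
  then show ?thesis using assms by (simp add: reroot_def unrot_rot)
qed

lemma inj_on_reroot:
  assumes c: "2 \<le> c" "c \<le> n"
  shows "inj_on (reroot n c) {p \<in> parents n. p c = 1}"
proof (rule inj_onI)
  fix p p' assume p: "p \<in> {p \<in> parents n. p c = 1}" "p' \<in> {p \<in> parents n. p c = 1}"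
    and eq: "reroot n c p = reroot n c p'"
  show "p = p'"
  proof (rule PiE_ext)
    show "p \<in> (\<Pi>\<^sub>E i\<in>{2..n}. {1..<i})" "p' \<in> (\<Pi>\<^sub>E i\<in>{2..n}. {1..<i})"
      using p by (auto simp: parents_def)
    fix x assume x: "x \<in> {2..n}"
    show "p x = p' x"
    proof (cases "x = c")
      case False
      then have "rot c (p x) = rot c (p' x)"
        using reroot_rot[of c x n] x c eq by (metis atLeastAtMost_iff)
      then show ?thesis using c unrot_rot[of c] by (metis One_nat_def Suc_1 Suc_leD)
    qed (use p in auto)
  qed
qed

text \<open>
  Rerooting does not change the unlabeled tree: as sets of edges the two trees differ by the
  relabeling \<open>rot c\<close> only.
\<close>

lemma relabel_rot_tree:
  assumes c: "2 \<le> c" "c \<le> n" "p c = 1"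
  shows "relabel (rot c) (tree n p) = tree n (reroot n c p)"
proof -
  have "rot c ` ({2..n} - {c}) = {3..n}"
  proof
    show "{3..n} \<subseteq> rot c ` ({2..n} - {c})"
    proof
      fix y assume "y \<in> {3..n}"
      then show "y \<in> rot c ` ({2..n} - {c})"
        using c by (intro image_eqI[of _ _ "unrot c y"]) (auto simp: rot_def unrot_def)
    qed
  qed (use c in \<open>auto simp: rot_def\<close>)
  then have split: "{2..n} = insert 2 (rot c ` ({2..n} - {c}))"
    using c by auto
  have "(\<lambda>y. {reroot n c p y, y}) ` {2..n} =
      insert {reroot n c p 2, 2} ((\<lambda>x. {reroot n c p (rot c x), rot c x}) ` ({2..n} - {c}))"
    by (subst split) (simp add: image_image)
  also have "\<dots> = insert {1, 2} ((\<lambda>x. {rot c (p x), rot c x}) ` ({2..n} - {c}))"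
  proof -
    have "reroot n c p 2 = 1" using c by (simp add: reroot_def)
    moreover have "(\<lambda>x. {reroot n c p (rot c x), rot c x}) ` ({2..n} - {c}) =
        (\<lambda>x. {rot c (p x), rot c x}) ` ({2..n} - {c})"
      using c by (intro image_cong) (auto simp: reroot_rot)
    ultimately show ?thesis by simp
  qed
  also have "\<dots> = (\<lambda>x. {rot c (p x), rot c x}) ` insert c ({2..n} - {c})"
  proof -
    have "{1, 2} = {rot c (p c), rot c c}" using c by (auto simp: rot_def)
    then show ?thesis by (simp only: image_insert)
  qed
  also have "insert c ({2..n} - {c}) = {2..n}" using c by auto
  finally show ?thesis
    using permutes_image[OF rot_permutes[of c n]] c
    by (simp add: relabel_def tree_def image_image)
qed

text \<open>
  A uniform permutation composed with \<open>rot c\<close> is again uniform, so the selection cannot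
  distinguish a tree from its rerooted copy.
\<close>

lemma misses_reroot:
  assumes c: "2 \<le> c" "c \<le> n" "p c = 1"
  shows "misses H n (reroot n c p) (rot c x) = misses H n p x"
proof -
  have \<rho>: "rot c permutes {1..n}" using c by (intro rot_permutes) auto
  let ?A = "{\<sigma>. \<sigma> permutes {1..n} \<and> \<sigma> (rot c x) \<notin> H (relabel \<sigma> (tree n (reroot n c p)))}"
  let ?B = "{\<sigma>. \<sigma> permutes {1..n} \<and> \<sigma> x \<notin> H (relabel \<sigma> (tree n p))}"
  have "bij_betw (\<lambda>\<sigma>. \<sigma> \<circ> rot c) ?A ?B"
  proof (rule bij_betwI[where g = "\<lambda>\<sigma>. \<sigma> \<circ> inv (rot c)"])
    show "(\<lambda>\<sigma>. \<sigma> \<circ> rot c) \<in> ?A \<rightarrow> ?B"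
      using \<rho> by (auto intro: permutes_compose
          simp: relabel_rot_tree[where c = c and p = p, OF c, symmetric] relabel_relabel)
    show "(\<lambda>\<sigma>. \<sigma> \<circ> inv (rot c)) \<in> ?B \<rightarrow> ?A"
      using \<rho> by (auto intro: permutes_compose permutes_inv
          simp: relabel_rot_tree[where c = c and p = p, OF c, symmetric] relabel_relabel comp_assoc
            permutes_inv_o permutes_inverses)
  qed (use \<rho> in \<open>auto simp: comp_assoc permutes_inv_o\<close>)
  then show ?thesis unfolding misses_def by (rule bij_betw_same_card)
qed

text \<open>
  The path from \<open>v\<close> up to \<open>c\<close> passes through labels greater than \<open>c\<close>, which the rotation fixes.
  It now ends at \<open>c\<close>, one step before the old root.
\<close>

lemma depth_reroot:
  assumes p: "p \<in> parents n" and v: "2 \<le> v" "v \<le> n" and "branch p v = c" "c \<noteq> v"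
  shows "Suc (depth (reroot n c p) v) = depth p v"
  using v assms(4,5)
proof (induction v rule: less_induct)
  case (less v)
  have c: "2 \<le> c" "c < v" "p c = 1"
    using branch_child_of_root[OF p less.prems(1,2)] less.prems by auto
  have pv: "1 < p v" "p v < v" "branch p (p v) = c"
    using less.prems parent_less[OF p less.prems(1,2)] by (auto simp: branch.simps[of p v] split: if_splits)
  have le: "c \<le> p v" using branch_child_of_root[OF p, of "p v"] pv less.prems by auto
  have "rot c v = v" using c by (simp add: rot_def)
  then have r: "reroot n c p v = rot c (p v)"
    using reroot_rot[of c v n p] c less.prems by simp
  show ?case
  proof (cases "p v = c")
    case True
    then show ?thesis using r c pv
      by (simp add: depth.simps[of _ v] depth.simps[of p c] depth.simps[of _ 1] rot_def
          depth.simps[of _ "Suc 0"])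
  next
    case False
    then have "reroot n c p v = p v" using le r by (simp add: rot_def)
    then show ?thesis using less.IH[of "p v"] pv less.prems False
      by (simp add: depth.simps[of _ v])
  qed
qed

text \<open>
  Sort the trees by \<open>c = branch p v\<close> and reroot at \<open>c\<close>, which is injective for fixed \<open>c\<close>. If
  \<open>c = v\<close>, missing \<open>v\<close> becomes missing the root. For each of the \<open>v - 2\<close> other values of \<open>c\<close>,
  the vertex \<open>v\<close> keeps its label and has smaller depth. With \<open>M d\<close> for the left-hand side and
  \<open>R\<close> for the sum on the right this gives \<open>M (d + 1) \<le> (v - 2) M d + R\<close>.
\<close>

lemma sum_misses_shallow_le:
  assumes v: "1 \<le> v" "v \<le> n"
  shows "(\<Sum>p\<in>{p \<in> parents n. depth p v \<le> d}. misses H n p v)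
    \<le> v ^ d * (\<Sum>p\<in>parents n. misses H n p 1)"
proof (cases "v = 1")
  case True
  then show ?thesis by (auto intro: sum_mono2)
next
  case False
  then have v2: "2 \<le> v" using v by simp
  define M where "M d = (\<Sum>p\<in>{p \<in> parents n. depth p v \<le> d}. misses H n p v)" for d
  define R where "R = (\<Sum>p\<in>parents n. misses H n p 1)"
  have transport: "(\<Sum>p\<in>A. misses H n p x) \<le> (\<Sum>p\<in>B. misses H n p (rot c x))"
    if "2 \<le> c" "c \<le> n" "A \<subseteq> {p \<in> parents n. p c = 1}" "reroot n c ` A \<subseteq> B" "finite B"
    for A B c x
  proof -
    have "(\<Sum>p\<in>A. misses H n p x) = (\<Sum>p\<in>A. misses H n (reroot n c p) (rot c x))"
      using that by (intro sum.cong) (auto simp: misses_reroot)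
    also have "\<dots> = (\<Sum>p\<in>reroot n c ` A. misses H n p (rot c x))"
      using inj_on_subset[OF inj_on_reroot that(3)] that by (simp add: sum.reindex)
    also have "\<dots> \<le> (\<Sum>p\<in>B. misses H n p (rot c x))"
      using that by (intro sum_mono2) auto
    finally show ?thesis .
  qed
  let ?B = "\<lambda>d c. {p \<in> parents n. depth p v \<le> d \<and> branch p v = c}"
  have bc: "p (branch p v) = 1" "branch p v \<in> {2..v}" if "p \<in> parents n" for p
    using branch_child_of_root[OF that v2 v(2)] by auto
  have own: "(\<Sum>p\<in>?B d v. misses H n p v) \<le> R" for d
  proof -
    have "(\<Sum>p\<in>?B d v. misses H n p v) \<le> (\<Sum>p\<in>parents n. misses H n p (rot v v))"
      using v2 v bc by (intro transport) (auto intro: reroot_parents)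
    then show ?thesis by (simp add: R_def rot_def)
  qed
  have other: "(\<Sum>p\<in>?B (Suc d) c. misses H n p v) \<le> M d" if c: "c \<in> {2..<v}" for d c
  proof -
    have "(\<Sum>p\<in>?B (Suc d) c. misses H n p v)
        \<le> (\<Sum>p\<in>{p \<in> parents n. depth p v \<le> d}. misses H n p (rot c v))"
    proof (rule transport)
      show "reroot n c ` ?B (Suc d) c \<subseteq> {p \<in> parents n. depth p v \<le> d}"
        using c v v2 depth_reroot[OF _ v2 v(2)] by (fastforce intro: reroot_parents)
    qed (use c v bc in auto)
    moreover have "rot c v = v" using c by (simp add: rot_def)
    ultimately show ?thesis by (simp add: M_def)
  qed
  have step: "M (Suc d) \<le> (v - 2) * M d + R" for d
  proof -
    have "M (Suc d) = (\<Sum>c\<in>{2..v}. \<Sum>p\<in>?B (Suc d) c. misses H n p v)"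
    proof -
      have "(\<Sum>c\<in>{2..v}. \<Sum>p\<in>{p \<in> {p \<in> parents n. depth p v \<le> Suc d}. branch p v = c}. misses H n p v)
         = M (Suc d)"
        unfolding M_def by (rule sum.group) (use bc in auto)
      moreover have "{p \<in> {p \<in> parents n. depth p v \<le> Suc d}. branch p v = c} = ?B (Suc d) c" for c
        by auto
      ultimately show ?thesis by simp
    qed
    also have "{2..v} = insert v {2..<v}" using v2 by auto
    also have "(\<Sum>c\<in>insert v {2..<v}. \<Sum>p\<in>?B (Suc d) c. misses H n p v) =
        (\<Sum>p\<in>?B (Suc d) v. misses H n p v) + (\<Sum>c\<in>{2..<v}. \<Sum>p\<in>?B (Suc d) c. misses H n p v)"
      by simp
    also have "(\<Sum>c\<in>{2..<v}. \<Sum>p\<in>?B (Suc d) c. misses H n p v) \<le> (\<Sum>c\<in>{2..<v}. M d)"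
      using other by (intro sum_mono) auto
    finally show ?thesis using own[of "Suc d"] by simp
  qed
  have "M d \<le> v ^ d * R" for d
  proof (induction d)
    case 0
    have "depth p v \<noteq> 0" if "p \<in> parents n" for p
      using parent_less[OF that v2 v(2)] v2 by (simp add: depth.simps[of p v])
    then have "{p \<in> parents n. depth p v \<le> 0} = {}" by auto
    then have "M 0 = 0" unfolding M_def by (simp only: sum.empty)
    then show ?case by simp
  next
    case (Suc d)
    have "M (Suc d) \<le> (v - 2) * (v ^ d * R) + v ^ d * R"
      using step[of d]
    proof (rule order_trans)
      have "1 * R \<le> v ^ d * R" using v(1) by (intro mult_le_mono1 one_le_power)
      then show "(v - 2) * M d + R \<le> (v - 2) * (v ^ d * R) + v ^ d * R"
        using mult_le_mono2[OF Suc, of "v - 2"] by linarith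
    qed
    also have "\<dots> = Suc (v - 2) * (v ^ d * R)" by simp
    also have "\<dots> \<le> v * (v ^ d * R)" using v2 by (intro mult_le_mono1) simp
    finally show ?case by (simp add: mult.assoc)
  qed
  then show ?thesis by (simp add: M_def R_def)
qed

section \<open>The lower bound on the error\<close>

lemma prob_root_in_le:
  assumes H: "selects_vertices K H" and K: "1 \<le> K" and n: "2 * K \<le> n" and D: "4 * K \<le> 2 ^ D"
  shows "prob_root_in H n \<le> 1 - 1 / (4 * (2 * K) ^ D)"
proof -
  let ?N = "card (parents n) * fact n"
  define R where "R = (\<Sum>p\<in>parents n. misses H n p 1)"
  have "K * ?N = (\<Sum>p\<in>parents n. (card {1..2*K} - K) * fact n)" by simp
  also have "\<dots> \<le> (\<Sum>p\<in>parents n. \<Sum>v\<in>{1..2*K}. misses H n p v)"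
    using K n by (intro sum_mono sum_misses_ge[OF H]) auto
  also have "\<dots> = (\<Sum>v\<in>{1..2*K}. \<Sum>p\<in>parents n. misses H n p v)" by (rule sum.swap)
  finally have avg: "K * ?N \<le> \<dots>" .
  obtain v where v: "v \<in> {1..2*K}" "?N \<le> 2 * (\<Sum>p\<in>parents n. misses H n p v)"
  proof (rule ccontr)
    assume "\<not> thesis"
    then have "\<And>v. v \<in> {1..2*K} \<Longrightarrow> 2 * (\<Sum>p\<in>parents n. misses H n p v) < ?N"
      using that by (meson not_le)
    then have "(\<Sum>v\<in>{1..2*K}. 2 * (\<Sum>p\<in>parents n. misses H n p v)) < (\<Sum>v\<in>{1..2*K}. ?N)"
      using K by (intro sum_strict_mono) auto
    then show False using avg by (simp add: sum_distrib_left[symmetric])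
  qed
  have v12: "1 \<le> v" "v \<le> n" using v n by auto
  let ?deep = "{p \<in> parents n. D < depth p v}"
  let ?shallow = "{p \<in> parents n. depth p v \<le> D}"
  have "card ?deep * (8 * K) \<le> card ?deep * 2 ^ Suc D" using D by (intro mult_le_mono2) simp
  also have "\<dots> \<le> v * card (parents n)" by (rule card_deep_le[OF v12])
  also have "\<dots> \<le> (2 * K) * card (parents n)" using v by (intro mult_le_mono1) simp
  finally have "(2 * K) * (4 * card ?deep) \<le> (2 * K) * card (parents n)" by (simp add: mult_ac)
  then have deep: "4 * card ?deep \<le> card (parents n)" using K by simp
  have "(\<Sum>p\<in>?deep. misses H n p v) \<le> card ?deep * fact n"
    using sum_bounded_above[of ?deep "\<lambda>p. misses H n p v" "fact n"] misses_le by simp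
  then have "4 * (\<Sum>p\<in>?deep. misses H n p v) \<le> ?N"
    using mult_le_mono1[OF deep, of "fact n"] by linarith
  moreover have "(\<Sum>p\<in>parents n. misses H n p v) =
      (\<Sum>p\<in>?shallow. misses H n p v) + (\<Sum>p\<in>?deep. misses H n p v)"
    by (subst sum.union_disjoint[symmetric]) (auto intro: sum.cong)
  moreover have "(\<Sum>p\<in>?shallow. misses H n p v) \<le> v ^ D * R"
    unfolding R_def by (rule sum_misses_shallow_le[OF v12])
  moreover have "v ^ D * R \<le> (2 * K) ^ D * R" using v by (intro mult_le_mono1 power_mono) auto
  ultimately have "?N \<le> 4 * ((2 * K) ^ D * R)" using v(2) by linarith
  then have "real ?N \<le> real (4 * ((2 * K) ^ D * R))" by (rule of_nat_mono)
  then have "real ?N \<le> 4 * (2 * K) ^ D * real R" by (simp add: mult.assoc)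
  moreover have "0 < real ?N" by (simp add: card_gt_0_iff)
  ultimately have "1 / (4 * (2 * K) ^ D) \<le> real R / real ?N"
    using K by (simp add: field_simps)
  then show ?thesis
    using K n by (simp add: prob_root_in_eq_misses R_def)
qed

text \<open>
  With \<open>x = ln K\<close>, the hypothesis says that \<open>D ln 2 \<le> 3 ln 2 + x\<close>, which is at most \<open>4 x\<close>, so
  \<open>D ln (2 K)\<close> is at most a constant times \<open>x\<^sup>2\<close>. For \<open>K = 1\<close> the right-hand side is 1 and
  the inequality fails.
\<close>

lemma power_le_exp_ln_squared:
  assumes K: "2 \<le> K" and D: "2 ^ D \<le> 8 * K"
  shows "2 * (2 * real K) ^ D \<le> exp (30 * (ln K)\<^sup>2)"
proof -
  define a x where "a = ln (2::real)" and "x = ln (real K)"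
  have a: "2 / 3 \<le> a" unfolding a_def by (rule ln2_ge_two_thirds)
  have x: "a \<le> x" using K by (simp add: a_def x_def)
  have "real (2 ^ D) \<le> real (8 * K)" using D by (rule of_nat_mono)
  then have "ln (2 ^ D :: real) \<le> ln (2 ^ 3 * real K)" using K by (intro ln_mono) auto
  then have "D * a \<le> 3 * a + x"
    using K by (simp add: ln_mult ln_realpow a_def x_def del: power_numeral)
  then have "D * a \<le> 4 * x" using x by simp
  moreover have "D * (2/3) \<le> D * a" using a by (intro mult_left_mono) auto
  ultimately have D6: "D \<le> 6 * x" by linarith
  have "ln (2 * (2 * real K) ^ D) = a + D * (a + x)"
    using K by (simp add: ln_mult ln_realpow a_def x_def algebra_simps)
  also have "\<dots> \<le> a + (6 * x) * (2 * x)"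
    using D6 x a by (intro add_left_mono mult_mono) auto
  also have "a \<le> 2 * x\<^sup>2"
  proof -
    have "2 / 3 * x \<le> x * x" using x a by (intro mult_right_mono) auto
    then have "2 / 3 * x \<le> x\<^sup>2" by (simp add: power2_eq_square)
    then show ?thesis using x a by linarith
  qed
  also have "2 * x\<^sup>2 + (6 * x) * (2 * x) \<le> 30 * x\<^sup>2" by (simp add: power2_eq_square)
  finally have "ln (2 * (2 * real K) ^ D) \<le> 30 * x\<^sup>2" by simp
  then have "exp (ln (2 * (2 * real K) ^ D)) \<le> exp (30 * x\<^sup>2)" by simp
  then show ?thesis using K by (simp add: x_def)
qed

theorem theorem4:
  "\<exists>\<epsilon>0::real. \<epsilon>0 > 0 \<and>
     (\<forall>\<epsilon>::real. 0 < \<epsilon> \<and> \<epsilon> \<le> \<epsilon>0 \<longrightarrow>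
       (\<forall>K::nat. K > 0 \<longrightarrow>
         (\<forall>H :: lgraph \<Rightarrow> nat set.
            selects_vertices K H \<and>
            liminf (\<lambda>n. ereal (prob_root_in H n)) \<ge> ereal (1 - \<epsilon>) \<longrightarrow>
            real K \<ge> exp (sqrt (1 / 30 * ln (1 / (2 * \<epsilon>)))))))"
  \<comment> \<open>The threshold is for the case \<open>K = 1\<close>, where the root is missed with probability at least
    \<open>1/16\<close>, so that no selection succeeds with probability \<open>1 - \<epsilon>\<close> for \<open>\<epsilon> < 1/16\<close>.\<close>
proof (intro exI[of _ "1/32::real"] conjI allI impI)
  fix \<epsilon> :: real and K :: nat and H :: "lgraph \<Rightarrow> nat set"
  assume \<epsilon>: "0 < \<epsilon> \<and> \<epsilon> \<le> 1/32" and K: "K > 0"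
    and H: "selects_vertices K H \<and> liminf (\<lambda>n. ereal (prob_root_in H n)) \<ge> ereal (1 - \<epsilon>)"
  define D where "D = (LEAST D. 4 * K \<le> 2 ^ D)"
  have "4 * K \<le> 2 ^ (4 * K)" by (meson less_exp less_imp_le)
  then have D: "4 * K \<le> 2 ^ D" unfolding D_def by (rule LeastI)
  have D8: "2 ^ D \<le> 8 * K"
  proof (cases D)
    case (Suc d)
    then have "\<not> 4 * K \<le> 2 ^ d" using not_less_Least[of d "\<lambda>D. 4 * K \<le> 2 ^ D"] D_def by simp
    then show ?thesis using Suc by simp
  qed (use K in simp)
  let ?\<delta> = "1 / (4 * (2 * real K) ^ D)"
  have "prob_root_in H n \<le> 1 - ?\<delta>" if "2 * K \<le> n" for n
    using prob_root_in_le[OF _ _ that D] H K by simp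
  then have "eventually (\<lambda>n. ereal (prob_root_in H n) \<le> ereal (1 - ?\<delta>)) sequentially"
    unfolding eventually_sequentially by auto
  then have "liminf (\<lambda>n. ereal (prob_root_in H n)) \<le> ereal (1 - ?\<delta>)"
    by (intro Liminf_le) auto
  then have "ereal (1 - \<epsilon>) \<le> ereal (1 - ?\<delta>)" using H order_trans by blast
  then have "?\<delta> \<le> \<epsilon>" by simp
  then have \<delta>: "1 / (2 * \<epsilon>) \<le> 2 * (2 * real K) ^ D"
    using \<epsilon> K by (simp add: field_simps)
  show "real K \<ge> exp (sqrt (1 / 30 * ln (1 / (2 * \<epsilon>))))"
  proof (cases "K = 1")
    case True
    have "D \<le> 2" unfolding D_def True by (rule Least_le) simp
    then have "(2::real) ^ D \<le> 2 ^ 2" by (intro power_increasing) auto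
    \<comment> \<open>this contradicts \<open>\<epsilon> \<le> 1/32\<close>\<close>
    then have "1 / (2 * \<epsilon>) \<le> 8" using \<delta> True by simp
    then show ?thesis using \<epsilon> by (simp add: field_simps)
  next
    case False
    then have "1 / (2 * \<epsilon>) \<le> exp (30 * (ln K)\<^sup>2)"
      using \<delta> power_le_exp_ln_squared[OF _ D8] K by linarith
    then have "ln (1 / (2 * \<epsilon>)) \<le> 30 * (ln K)\<^sup>2"
      using \<epsilon> by (metis ln_exp ln_mono exp_gt_zero divide_pos_pos mult_pos_pos zero_less_numeral zero_less_one)
    then have "sqrt (1 / 30 * ln (1 / (2 * \<epsilon>))) \<le> sqrt ((ln K)\<^sup>2)"
      by (intro real_sqrt_le_mono) simp
    also have "\<dots> = ln K" using K by simp
    finally show ?thesis using K by (metis exp_le_cancel_iff exp_ln of_nat_0_less_iff)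
  qed
qed simp

end
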